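(* Let $N\in\mathbb{N}^+$ and $J=(J_{\imath,\jmath})_{2^N\times N}\in M_{2^N\times N}(\mathbb{S})$. If $\mathcal{M}(J)$ is invertible, then $$\sigma_N\,\mathcal{M}(J)^{-1}=\mathcal{M}(J)^{-1}D_N(J),$$ where $D_N(J):=\mathrm{diag}(J_{1,N},J_{2,N},\dots,J_{2^N,N})$ is the $2^N\times 2^N$ diagonal matrix with these diagonal entries.
   Context: $\mathbb{H}$ is the quaternions, $\mathbb{S}=\{q\in\mathbb{H}:q^2=-1\}$, and $M_{m\times n}(A)$ denotes the $m\times n$ matrices with entries in $A$. For $I=(I_1,\dots,I_N)\in\mathbb{S}^N$ and $m\in\{1,\dots,2^N\}$, let $(m_Nm_{N-1}\cdots m_1)_2$ be the binary expansion of $m-1$, set $I_0:=1$ and $I(m):=(I_NI_{N-1})^{m_N}(I_{N-1}I_{N-2})^{m_{N-1}}\cdots(I_1I_0)^{m_1}$; let $\zeta(I):=(I(1),\dots,I(2^N))$, a row vector. For $J\in M_{2^N\times N}(\mathbb{S})$ with rows $J_1,\dots,J_{2^N}\in\mathbb{S}^N$, $\mathcal{M}(J)\in M_{2^N}(\mathbb{H})$ is the square matrix whose $\imath$-th row is $\zeta(J_\imath)$. A square quaternionic matrix is invertible if it has a two-sided inverse. The matrix $\sigma_N=(\sigma^{(N)}_{\imath,\jmath})\in M_{2^N}(\mathbb{R})$ is defined by $\sigma^{(N)}_{\imath,\jmath}=(-1)^{N+\jmath}$ if $\imath+\jmath=2^N+1$ and $0$ otherwise. *)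

theory Defs
  imports Complex_Main "Jordan_Normal_Form.Matrix"
begin

section \<open>Quaternions\<close>

text \<open>\<open>Quat a b c d\<close> stands for \<open>a + b i + c j + d k\<close>, with \<open>i\<^sup>2 = j\<^sup>2 = k\<^sup>2 = -1\<close>,
  \<open>i j = k\<close>, \<open>j k = i\<close> and \<open>k i = j\<close>.\<close>

datatype quat = Quat (qre: real) (qim1: real) (qim2: real) (qim3: real)

lemma quat_eq_iff:
  "x = y \<longleftrightarrow> qre x = qre y \<and> qim1 x = qim1 y \<and> qim2 x = qim2 y \<and> qim3 x = qim3 y"
  by (cases x; cases y) simp

instantiation quat :: real_div_algebra
begin

definition zero_quat :: quat where "0 = Quat 0 0 0 0"

definition one_quat :: quat where "1 = Quat 1 0 0 0"

definition plus_quat :: "quat \<Rightarrow> quat \<Rightarrow> quat" where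
  "x + y = Quat (qre x + qre y) (qim1 x + qim1 y) (qim2 x + qim2 y) (qim3 x + qim3 y)"

definition uminus_quat :: "quat \<Rightarrow> quat" where
  "- x = Quat (- qre x) (- qim1 x) (- qim2 x) (- qim3 x)"

definition minus_quat :: "quat \<Rightarrow> quat \<Rightarrow> quat" where
  "x - y = Quat (qre x - qre y) (qim1 x - qim1 y) (qim2 x - qim2 y) (qim3 x - qim3 y)"

definition times_quat :: "quat \<Rightarrow> quat \<Rightarrow> quat" where
  "x * y = Quat
     (qre x * qre y - qim1 x * qim1 y - qim2 x * qim2 y - qim3 x * qim3 y)
     (qre x * qim1 y + qim1 x * qre y + qim2 x * qim3 y - qim3 x * qim2 y)
     (qre x * qim2 y - qim1 x * qim3 y + qim2 x * qre y + qim3 x * qim1 y)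
     (qre x * qim3 y + qim1 x * qim2 y - qim2 x * qim1 y + qim3 x * qre y)"

definition scaleR_quat :: "real \<Rightarrow> quat \<Rightarrow> quat" where
  "scaleR r x = Quat (r * qre x) (r * qim1 x) (r * qim2 x) (r * qim3 x)"

definition inverse_quat :: "quat \<Rightarrow> quat" where
  "inverse x =
     (let n = (qre x)\<^sup>2 + (qim1 x)\<^sup>2 + (qim2 x)\<^sup>2 + (qim3 x)\<^sup>2
      in Quat (qre x / n) (- qim1 x / n) (- qim2 x / n) (- qim3 x / n))"

definition divide_quat :: "quat \<Rightarrow> quat \<Rightarrow> quat" where
  "divide_quat x y = x * inverse y"

lemmas quat_ops_defs =
  zero_quat_def one_quat_def plus_quat_def uminus_quat_def minus_quat_def times_quat_def
  scaleR_quat_def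

lemma quat_norm_sq_nonzero:
  assumes "x \<noteq> 0"
  shows "(qre x)\<^sup>2 + (qim1 x)\<^sup>2 + (qim2 x)\<^sup>2 + (qim3 x)\<^sup>2 \<noteq> (0::real)"
proof
  assume *: "(qre x)\<^sup>2 + (qim1 x)\<^sup>2 + (qim2 x)\<^sup>2 + (qim3 x)\<^sup>2 = (0::real)"
  have "(qre x)\<^sup>2 = 0 \<and> (qim1 x)\<^sup>2 = 0 \<and> (qim2 x)\<^sup>2 = 0 \<and> (qim3 x)\<^sup>2 = 0"
    using * zero_le_power2[of "qre x"] zero_le_power2[of "qim1 x"]
      zero_le_power2[of "qim2 x"] zero_le_power2[of "qim3 x"] by linarith
  then show False
    using assms by (simp add: quat_eq_iff zero_quat_def)
qed

instance
proof
  fix x :: quat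
  let ?n = "(qre x)\<^sup>2 + (qim1 x)\<^sup>2 + (qim2 x)\<^sup>2 + (qim3 x)\<^sup>2"
  assume "x \<noteq> 0"
  then have n: "?n \<noteq> 0" by (rule quat_norm_sq_nonzero)
  define s where "s = 1 / ?n"
  have "s * ?n = 1"
    using n by (simp add: s_def)
  then have s: "s * (qre x * qre x) + s * (qim1 x * qim1 x) + s * (qim2 x * qim2 x)
      + s * (qim3 x * qim3 x) = 1"
    by (simp only: distrib_left power2_eq_square)
  have inv: "inverse x = Quat (s * qre x) (- (s * qim1 x)) (- (s * qim2 x)) (- (s * qim3 x))"
    by (simp add: quat_eq_iff inverse_quat_def s_def Let_def)
  show "inverse x * x = 1" "x * inverse x = 1"
    using s by (simp_all add: inv times_quat_def one_quat_def mult_ac)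
qed (simp_all add: quat_eq_iff quat_ops_defs divide_quat_def inverse_quat_def algebra_simps)

end

definition imag_units :: "quat set" where
  "imag_units = {q. q\<^sup>2 = - 1}"


section \<open>The matrices\<close>

text \<open>Vectors and matrices are indexed from \<open>0\<close> in the library and from \<open>1\<close> in the mathematics.
  In \<open>comp0 I k\<close>, \<open>bin_digit m k\<close> and \<open>I_prod I m\<close> the arguments \<open>k\<close> and \<open>m\<close> keep the 1-based
  numbering (with \<open>comp0 I 0 = 1\<close> playing the role of the entry numbered \<open>0\<close>); constructing or
  reading a vector or matrix shifts by one. The factors of \<open>I_prod I m\<close> do not commute, and
  appear with \<open>k\<close> decreasing from left to right.\<close>

definition comp0 :: "quat vec \<Rightarrow> nat \<Rightarrow> quat" where
  "comp0 I k = (if k = 0 then 1 else I $ (k - 1))"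

definition bin_digit :: "nat \<Rightarrow> nat \<Rightarrow> nat" where
  "bin_digit m k = ((m - 1) div 2 ^ (k - 1)) mod 2"

definition I_prod :: "quat vec \<Rightarrow> nat \<Rightarrow> quat" where
  "I_prod I m =
     prod_list (map (\<lambda>k. (comp0 I k * comp0 I (k - 1)) ^ bin_digit m k) (rev [1..<dim_vec I + 1]))"

definition zeta :: "quat vec \<Rightarrow> quat vec" where
  "zeta I = vec (2 ^ dim_vec I) (\<lambda>j. I_prod I (j + 1))"

definition M_mat :: "quat mat \<Rightarrow> quat mat" where
  "M_mat J = mat_of_rows (2 ^ dim_col J) (map zeta (rows J))"

definition sigma_mat :: "nat \<Rightarrow> real mat" where
  "sigma_mat N = mat (2 ^ N) (2 ^ N)
     (\<lambda>(i, j). if (i + 1) + (j + 1) = 2 ^ N + 1 then (- 1) ^ (N + (j + 1)) else 0)"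

definition D_mat :: "nat \<Rightarrow> quat mat \<Rightarrow> quat mat" where
  "D_mat N J = mat_diag (2 ^ N) (\<lambda>i. J $$ (i, N - 1))"

definition mat_inv :: "quat mat \<Rightarrow> quat mat" where
  "mat_inv A = (THE B. inverts_mat A B \<and> inverts_mat B A)"

lemma mat_inv_eqI:
  assumes A: "square_mat A" and AB: "inverts_mat A B" and BA: "inverts_mat B A"
  shows "mat_inv A = B"
proof -
  have car: "C \<in> carrier_mat (dim_row A) (dim_row A)"
    if "inverts_mat A C" "inverts_mat C A" for C
  proof (rule carrier_matI)
    have "dim_col (A * C) = dim_row A" "dim_col (C * A) = dim_row C"
      using that by (simp_all add: inverts_mat_def del: index_mult_mat)
    then show "dim_row C = dim_row A" "dim_col C = dim_row A"
      using A by simp_all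
  qed
  have A': "A \<in> carrier_mat (dim_row A) (dim_row A)"
    using A by auto
  have uniq: "C = B" if C: "inverts_mat A C" "inverts_mat C A" for C
  proof -
    have "C = C * (A * B)"
      using AB car[OF C] by (simp add: inverts_mat_def)
    also have "\<dots> = (C * A) * B"
      using assoc_mult_mat[OF car[OF C] A' car[OF AB BA]] by simp
    also have "\<dots> = B"
      using C(2) car[OF C] car[OF AB BA] by (simp add: inverts_mat_def)
    finally show ?thesis .
  qed
  show ?thesis
    unfolding mat_inv_def
  proof (rule the_equality)
    show "inverts_mat A B \<and> inverts_mat B A" using AB BA ..
    show "C = B" if "inverts_mat A C \<and> inverts_mat C A" for C
      using that by (elim conjE) (rule uniq)
  qed
qed

end

theory Submission
  imports Defs
begin

text \<open>Right multiplication of a row \<open>\<zeta>(I)\<close> by \<open>\<sigma>\<^sub>N\<close> replaces the binary digits of the column index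
  by their complements and adjusts the sign. Because \<open>I\<^sub>k\<^sup>2 = -1\<close>, left multiplication by \<open>I\<^sub>N\<close>
  does the same to the products \<open>I(m)\<close>: it cancels the first factor of the leading \<open>I\<^sub>N I\<^sub>N\<^sub>-\<^sub>1\<close>
  if the digit \<open>m\<^sub>N\<close> is 1 and supplies it if the digit is 0, and in both cases an \<open>I\<^sub>N\<^sub>-\<^sub>1\<close> is passed
  on to the lower digits. Hence \<open>\<M>(J) \<sigma>\<^sub>N = D\<^sub>N(J) \<M>(J)\<close>, which is conjugated by the inverse.\<close>

text \<open>Complementing acts separately on the digits below position \<open>i\<close> and on those
  above: with \<open>j = q * 2 ^ i + r\<close>, the complement has remainder
  \<open>2 ^ i - 1 - r\<close> and quotient \<open>t\<close>, and nothing is borrowed.\<close>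

lemma complement_div_power2:
  fixes j :: nat
  assumes "i \<le> n" "j < 2 ^ n"
  shows "(2 ^ n - 1 - j) div 2 ^ i = 2 ^ (n - i) - 1 - j div 2 ^ i"
proof -
  define q where "q = j div 2 ^ i"
  define r where "r = j mod 2 ^ i"
  have j: "j = q * 2 ^ i + r"
    unfolding q_def r_def by (simp only: div_mult_mod_eq)
  have n: "(2::nat) ^ n = 2 ^ (n - i) * 2 ^ i"
    using assms(1) by (simp flip: power_add)
  have r: "r < 2 ^ i"
    by (simp add: r_def)
  have "q * 2 ^ i < 2 ^ (n - i) * 2 ^ i"
    using assms(2) j n by linarith
  then obtain t where t: "2 ^ (n - i) = Suc (q + t)"
    by (auto dest: less_imp_Suc_add)
  have "2 ^ n - 1 - j = t * 2 ^ i + (2 ^ i - 1 - r)"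
    using r unfolding n t j by (simp add: algebra_simps)
  moreover have "(2 ^ i - 1 - r) div 2 ^ i = (0::nat)"
    by simp
  ultimately have "(2 ^ n - 1 - j) div 2 ^ i = t"
    by simp
  then show ?thesis
    using t by (simp add: q_def)
qed

text \<open>After the shift by \<open>k - 1\<close> places, the quotient \<open>q\<close> is
  subtracted from the odd number \<open>2 * 2 ^ (n - k) - 1\<close>, which flips its parity.\<close>

lemma bin_digit_complement:
  assumes "1 \<le> k" "k \<le> n" "j < 2 ^ n"
  shows "bin_digit (2 ^ n - 1 - j + 1) k = 1 - bin_digit (j + 1) k"
proof -
  define q where "q = j div 2 ^ (k - 1)"
  have pow: "(2::nat) ^ (n - (k - 1)) = 2 * 2 ^ (n - k)"
    using assms by (simp flip: power_Suc add: Suc_diff_le)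
  have e: "(2 ^ n - 1 - j) div 2 ^ (k - 1) = 2 * 2 ^ (n - k) - 1 - q"
    unfolding q_def pow[symmetric] using assms by (intro complement_div_power2) auto
  have "2 ^ n = 2 ^ (n - (k - 1)) * (2::nat) ^ (k - 1)"
    unfolding power_add[symmetric] using assms by simp
  then have "q < 2 * 2 ^ (n - k)"
    unfolding q_def pow using assms(3) by (simp only: less_mult_imp_div_less)
  then obtain t where t: "2 * 2 ^ (n - k) = Suc (q + t)"
    by (auto dest: less_imp_Suc_add)
  then have "odd (q + t)"
    by (metis even_Suc dvd_triv_left)
  then have "(2 * 2 ^ (n - k) - 1 - q) mod 2 = 1 - q mod 2"
    unfolding t by (cases "even q") (simp_all add: mod_2_eq_odd)
  then show ?thesis
    by (simp only: bin_digit_def add_diff_cancel_right' e q_def[symmetric])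
qed

text \<open>The sign depends on the lowest digit because the last factor \<open>x\<^sub>1 x\<^sub>0\<close> has \<open>x\<^sub>0 = 1\<close>, so
  that no factor is passed on below it.\<close>

lemma mult_digit_prod:
  fixes x :: "nat \<Rightarrow> 'a::ring_1" and d e :: "nat \<Rightarrow> nat"
  assumes "n \<ge> 1" "x 0 = 1"
    and "\<And>k. 1 \<le> k \<Longrightarrow> k \<le> n \<Longrightarrow> x k * x k = - 1"
    and "\<And>k. 1 \<le> k \<Longrightarrow> k \<le> n \<Longrightarrow> d k \<le> 1 \<and> e k = 1 - d k"
  shows "x n * prod_list (map (\<lambda>k. (x k * x (k - 1)) ^ d k) (rev [1..<n + 1]))
    = (- 1) ^ (n + d 1 + 1) * prod_list (map (\<lambda>k. (x k * x (k - 1)) ^ e k) (rev [1..<n + 1]))"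
  using assms
\<comment> \<open>\<open>d\<close> and \<open>e\<close> are generalized because a leading digit 0
  calls for the induction hypothesis with the two exchanged.\<close>
proof (induction n arbitrary: d e rule: nat_induct_at_least)
  case base
  then have "d 1 = 0 \<and> e 1 = 1 \<or> d 1 = 1 \<and> e 1 = 0"
    by fastforce
  moreover have "x 1 * x 1 = - 1"
    using base by simp
  ultimately show ?case
    using \<open>x 0 = 1\<close> by auto
next
  case (Suc n)
  let ?P = "\<lambda>d n. prod_list (map (\<lambda>k. (x k * x (k - 1)) ^ d k) (rev [1..<n + 1]))"
  have step: "?P f (Suc n) = (x (Suc n) * x n) ^ f (Suc n) * ?P f n" for f :: "nat \<Rightarrow> nat"
    by simp
  have sq: "x (Suc n) * (x (Suc n) * y) = - y" for y
    using Suc.prems(2)[of "Suc n"] by (simp flip: mult.assoc)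
  have dk: "d k \<le> 1 \<and> e k = 1 - d k" if "1 \<le> k" "k \<le> Suc n" for k
    using Suc.prems(3) that by blast
  have ed: "e k \<le> 1 \<and> d k = 1 - e k" if "1 \<le> k" "k \<le> Suc n" for k
    using dk[OF that] by auto
  have IH: "x n * ?P d n = (- 1) ^ (n + d 1 + 1) * ?P e n"
    using Suc.prems dk by (intro Suc.IH) auto
  have IH': "x n * ?P e n = (- 1) ^ (n + e 1 + 1) * ?P d n"
    using Suc.prems ed by (intro Suc.IH) auto
  have "d 1 + e 1 = 1"
    using dk[of 1] by auto
  then have "Suc n + d 1 + 1 + (n + e 1 + 1) = 2 * (n + 2)"
    by simp
  then have sgn: "(- 1) ^ (Suc n + d 1 + 1) * (- 1) ^ (n + e 1 + 1) = (1::'a)"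
    by (metis power_add power_mult power2_minus power_one)
  consider "d (Suc n) = 0" "e (Suc n) = 1" | "d (Suc n) = 1" "e (Suc n) = 0"
    using dk[of "Suc n"] by fastforce
  then show ?case
  proof cases
    case 1
    \<comment> \<open>Only the product for \<open>e\<close> contains the leading factor here, so the
      calculation starts from the right-hand side.\<close>
    have "(- 1) ^ (Suc n + d 1 + 1) * ?P e (Suc n)
        = (- 1) ^ (Suc n + d 1 + 1) * (x (Suc n) * (x n * ?P e n))"
      unfolding step by (simp only: 1 power_one_right mult.assoc)
    also have "\<dots> = (- 1) ^ (Suc n + d 1 + 1) * (x (Suc n) * ((- 1) ^ (n + e 1 + 1) * ?P d n))"
      unfolding IH' ..
    \<comment> \<open>The ring need not be commutative, but a power of -1 is central.\<close>
    also have "\<dots> = ((- 1) ^ (Suc n + d 1 + 1) * (- 1) ^ (n + e 1 + 1)) * (x (Suc n) * ?P d n)"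
      by (cases "even (n + e 1 + 1)") simp_all
    also have "\<dots> = x (Suc n) * ?P d (Suc n)"
      unfolding sgn step by (simp add: 1)
    finally show ?thesis ..
  next
    case 2
    \<comment> \<open>The square of \<open>x (Suc n)\<close> yields the one sign by which the
      exponents for \<open>n\<close> and \<open>Suc n\<close> differ.\<close>
    have "x (Suc n) * ?P d (Suc n) = x (Suc n) * (x (Suc n) * (x n * ?P d n))"
      unfolding step by (simp only: 2 power_one_right mult.assoc)
    also have "\<dots> = - ((- 1) ^ (n + d 1 + 1) * ?P e n)"
      unfolding sq IH ..
    also have "\<dots> = (- 1) ^ (Suc n + d 1 + 1) * ?P e (Suc n)"
      unfolding step by (simp add: 2)
    finally show ?thesis .
  qed
qed

lemma I_prod_complement:
  assumes "dim_vec I = n" "n \<ge> 1" "j < 2 ^ n"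
    and "\<And>k. k < n \<Longrightarrow> I $ k \<in> imag_units"
  shows "I $ (n - 1) * I_prod I (j + 1) = (- 1) ^ (n + (j + 1)) * I_prod I (2 ^ n - 1 - j + 1)"
proof -
  have "comp0 I n * I_prod I (j + 1)
      = (- 1) ^ (n + bin_digit (j + 1) 1 + 1) * I_prod I (2 ^ n - 1 - j + 1)"
    unfolding I_prod_def assms(1)
  proof (rule mult_digit_prod)
    show "comp0 I k * comp0 I k = - 1" if "1 \<le> k" "k \<le> n" for k
      using that assms(4)[of "k - 1"] by (simp add: comp0_def imag_units_def power2_eq_square)
    show "bin_digit (j + 1) k \<le> 1 \<and> bin_digit (2 ^ n - 1 - j + 1) k = 1 - bin_digit (j + 1) k"
      if "1 \<le> k" "k \<le> n" for k
      using bin_digit_complement[OF that assms(3)] by (simp add: bin_digit_def)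
  qed (use assms in \<open>simp_all add: comp0_def\<close>)
  \<comment> \<open>The lowest digit belonging to the 1-based index \<open>j + 1\<close> is the
    parity of \<open>j\<close>.\<close>
  moreover have "(- 1) ^ (n + bin_digit (j + 1) 1 + 1) = ((- 1) ^ (n + (j + 1)) :: quat)"
    by (simp add: bin_digit_def minus_one_power_iff)
  ultimately show ?thesis
    using assms(2) by (simp add: comp0_def)
qed

lemma M_mat_carrier:
  "J \<in> carrier_mat (2 ^ N) N \<Longrightarrow> M_mat J \<in> carrier_mat (2 ^ N) (2 ^ N)"
  by (rule carrier_matI) (simp_all add: M_mat_def)

lemma M_mat_index:
  assumes "J \<in> carrier_mat (2 ^ N) N" "i < 2 ^ N" "j < 2 ^ N"
  shows "M_mat J $$ (i, j) = I_prod (row J i) (j + 1)"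
proof -
  have "dim_row J = 2 ^ N" "dim_col J = N"
    using assms(1) by auto
  moreover from this have "M_mat J $$ (i, j) = zeta (row J i) $ j"
    using assms(2,3) unfolding M_mat_def by (subst mat_of_rows_index) simp_all
  ultimately show ?thesis
    using assms(3) by (simp add: zeta_def)
qed

lemma M_mat_mult_sigma_mat:
  assumes "N \<ge> 1" "J \<in> carrier_mat (2 ^ N) N" "elements_mat J \<subseteq> imag_units"
  shows "M_mat J * map_mat of_real (sigma_mat N) = D_mat N J * M_mat J"
proof (rule eq_matI)
  note M = M_mat_carrier[OF assms(2)]
  fix i j
  assume "i < dim_row (D_mat N J * M_mat J)" "j < dim_col (D_mat N J * M_mat J)"
  then have i: "i < 2 ^ N" and j: "j < 2 ^ N"
    using M by (auto simp: D_mat_def mat_diag_def)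
  \<comment> \<open>The 0-based row of the only nonzero entry in column \<open>j\<close> of
    \<open>sigma_mat N\<close>.\<close>
  let ?l = "2 ^ N - 1 - j"
  have l: "?l < 2 ^ N" "k + 1 + (j + 1) = 2 ^ N + 1 \<longleftrightarrow> k = ?l" for k
    using j by auto
  have "(M_mat J * map_mat of_real (sigma_mat N)) $$ (i, j)
      = (\<Sum>k = 0..<2 ^ N. M_mat J $$ (i, k) * of_real (sigma_mat N $$ (k, j)))"
    using M i j by (simp add: scalar_prod_def sigma_mat_def)
  also have "\<dots> = (\<Sum>k = 0..<2 ^ N. if k = ?l then M_mat J $$ (i, k) * (- 1) ^ (N + (j + 1)) else 0)"
    using j by (intro sum.cong refl) (simp only: sigma_mat_def index_mat(1) atLeast0LessThan
        lessThan_iff split l, simp)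
  also have "\<dots> = M_mat J $$ (i, ?l) * (- 1) ^ (N + (j + 1))"
    using l(1) by simp
  also have "\<dots> = (- 1) ^ (N + (j + 1)) * I_prod (row J i) (?l + 1)"
    unfolding M_mat_index[OF assms(2) i l(1)] by (simp add: minus_one_power_iff)
  also have "\<dots> = row J i $ (N - 1) * I_prod (row J i) (j + 1)"
  proof (rule I_prod_complement[symmetric])
    show "row J i $ k \<in> imag_units" if "k < N" for k
      using assms(2,3) i that elements_matI[of J "2 ^ N" N i k] by auto
  qed (use assms j in auto)
  also have "\<dots> = (D_mat N J * M_mat J) $$ (i, j)"
    unfolding D_mat_def mat_diag_mult_left[OF M] using assms i j by (simp add: M_mat_index)
  finally show "(M_mat J * map_mat of_real (sigma_mat N)) $$ (i, j) = (D_mat N J * M_mat J) $$ (i, j)" .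
qed (use M_mat_carrier[OF assms(2)] in \<open>auto simp: sigma_mat_def D_mat_def mat_diag_def\<close>)

theorem proposition10p6:
  fixes N :: nat and J :: "quat mat"
  assumes "N \<ge> 1"
    and "J \<in> carrier_mat (2 ^ N) N"
    and "elements_mat J \<subseteq> imag_units"
    and "invertible_mat (M_mat J)"
  shows "map_mat of_real (sigma_mat N) * mat_inv (M_mat J) = mat_inv (M_mat J) * D_mat N J"
proof -
  define S :: "quat mat" where "S = map_mat of_real (sigma_mat N)"
  let ?M = "M_mat J" and ?D = "D_mat N J" and ?n = "2 ^ N :: nat"
  obtain B where MB: "inverts_mat ?M B" and BM: "inverts_mat B ?M" and sq: "square_mat ?M"
    using assms(4) by (auto simp: invertible_mat_def)
  have inv: "mat_inv ?M = B"
    using mat_inv_eqI[OF sq MB BM] .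
  have M: "?M \<in> carrier_mat ?n ?n" and S: "S \<in> carrier_mat ?n ?n" and D: "?D \<in> carrier_mat ?n ?n"
    using M_mat_carrier[OF assms(2)] by (auto simp: S_def sigma_mat_def D_mat_def mat_diag_def)
  \<comment> \<open>\<open>inverts_mat\<close> does not state the size of \<open>B\<close>; it is
    read off from the column counts of both products.\<close>
  have "dim_col (?M * B) = ?n" "dim_col (B * ?M) = dim_row B"
    using MB BM M by (simp_all add: inverts_mat_def del: index_mult_mat)
  then have B: "B \<in> carrier_mat ?n ?n"
    using M by auto
  have one: "?M * B = 1\<^sub>m ?n" "B * ?M = 1\<^sub>m ?n"
    using MB BM M B by (auto simp: inverts_mat_def)
  \<comment> \<open>Inserting \<open>B * ?M\<close> creates \<open>?M * S\<close>, which is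
    exchanged for \<open>?D * ?M\<close>; then \<open>?M * B\<close> cancels on the right.\<close>
  have "S * B = B * ?M * (S * B)"
    using one S B by simp
  also have "\<dots> = B * (?M * S * B)"
    using M S B by (simp add: assoc_mult_mat[of _ ?n ?n _ ?n _ ?n])
  also have "\<dots> = B * (?D * ?M * B)"
    using M_mat_mult_sigma_mat[OF assms(1-3)] by (simp add: S_def)
  also have "\<dots> = B * ?D"
    using M D B one by (simp add: assoc_mult_mat[of _ ?n ?n _ ?n _ ?n])
  finally show ?thesis
    unfolding inv S_def .
qed

end
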